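(* Let $a, m, b$ be positive integers with $a < m < b$. The set $A = \{a, a+1, \dots, b\} \setminus \{m\}$ is a perfect extremal Skolem set if and only if $b = 3a$ and $m = (a+b)/2$.
   Context: A set $A = \{a_1,\dots,a_n\}$ of $n$ distinct positive integers is a perfect Skolem set if the set $\{1,2,\dots,2n\}$ can be partitioned into $n$ two-element subsets $\{s_i,t_i\}$ with $s_i - t_i = a_i$ for $i=1,\dots,n$. It is a perfect extremal Skolem set if in addition $\sum_{i=1}^n a_i = n^2$, where $n = |A|$. *)

theory Defs
  imports Complex_Main "HOL-Library.Disjoint_Sets"
begin

text \<open>
  The pairs \<open>{s\<^sub>i, t\<^sub>i}\<close> are indexed by the elements \<open>d = a\<^sub>i\<close> of \<open>A\<close> themselves; this is an
  indexing by \<open>1, \<dots>, n\<close> up to renaming, because the \<open>a\<^sub>i\<close> are distinct. The equation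
  \<open>s d = t d + d\<close> is \<open>s\<^sub>i - t\<^sub>i = a\<^sub>i\<close> without truncated subtraction, and it makes each
  \<open>{s d, t d}\<close> a two-element set since \<open>d > 0\<close>.
\<close>

definition perfect_skolem_set :: "nat set \<Rightarrow> bool" where
  "perfect_skolem_set A \<longleftrightarrow>
     finite A \<and> (\<forall>d\<in>A. d > 0) \<and>
     (\<exists>s t :: nat \<Rightarrow> nat.
        (\<forall>d\<in>A. s d = t d + d) \<and>
        disjoint_family_on (\<lambda>d. {s d, t d}) A \<and>
        (\<Union>d\<in>A. {s d, t d}) = {1..2 * card A})"

definition perfect_extremal_skolem_set :: "nat set \<Rightarrow> bool" where
  "perfect_extremal_skolem_set A \<longleftrightarrow> perfect_skolem_set A \<and> \<Sum>A = (card A)\<^sup>2"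

end

theory Submission
  imports Defs
begin

text \<open>
  The condition \<open>\<Sum>A = (card A)\<^sup>2\<close> alone already determines \<open>b\<close> and \<open>m\<close>. Put \<open>b = a + n\<close> and
  \<open>m = a + k\<close>, so that \<open>card A = n\<close>. Summing the arithmetic progression, the condition becomes
  \<open>2 * k = n * (2 * a + 1 - n)\<close>, and \<open>0 < k < n\<close> squeezes the integer factor \<open>2 * a + 1 - n\<close>
  strictly between \<open>0\<close> and \<open>2\<close>. Hence \<open>n = 2 * a\<close> and \<open>k = a\<close>; this
  is \<open>sum_punctured_interval_eq_card_squared_iff\<close>.

  Conversely, \<open>perfect_skolem_set_punctured_interval\<close> pairs up \<open>{1..4 * a}\<close> for the set
  \<open>{a..3 * a} - {2 * a}\<close>. Its \<open>2 * a\<close> differences sum to \<open>(2 * a)\<^sup>2\<close>, the sum of the upper half of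
  \<open>{1..4 * a}\<close> minus that of the lower half, so any pairing must join each \<open>x\<close> in the lower half to
  an element of the upper half, that is, be given by a permutation of \<open>{1..2 * a}\<close>.
  Multiplication by \<open>2\<close> permutes the nonzero residues modulo \<open>2 * a + 1\<close>; writing \<open>\<sigma>\<close> for this permutation of \<open>{1..2 * a}\<close>, the
  displacement \<open>\<sigma> x - x\<close> is \<open>x\<close> for \<open>x \<le> a\<close> and \<open>x - (2 * a + 1)\<close> for \<open>x > a\<close>, so it takes every
  value in \<open>{-a..a} - {0}\<close> exactly once. Joining \<open>x\<close> to \<open>2 * a + \<sigma> x\<close> therefore realises every
  difference in \<open>{a..3 * a} - {2 * a}\<close> exactly once.
\<close>

lemma sum_punctured_interval_eq_card_squared_iff:
  fixes a m b :: nat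
  assumes "a < m" and "m < b"
  shows "\<Sum>({a..b} - {m}) = (card ({a..b} - {m}))\<^sup>2 \<longleftrightarrow> b = 3 * a \<and> m = 2 * a"
proof -
  define n k where "n = b - a" and "k = m - a"
  have b: "b = a + n" and m: "m = a + k" and k: "0 < k" "k < n"
    using assms by (auto simp: n_def k_def)
  have card: "card ({a..b} - {m}) = n"
    using k by (simp add: b m)
  have "\<Sum>{a..b} = m + \<Sum>({a..b} - {m})"
    using assms by (intro sum.remove) auto
  moreover have "2 * \<Sum>{a..b} = (2 * a + n) * (n + 1)"
    unfolding b by (induction n) (auto simp: algebra_simps)
  ultimately have "2 * (a + k) + 2 * \<Sum>({a..b} - {m}) = (2 * a + n) * (n + 1)"
    by (simp add: m)
  then have "2 * (int a + int k) + 2 * int (\<Sum>({a..b} - {m})) = (2 * int a + int n) * (int n + 1)"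
    by (metis (mono_tags) of_nat_1 of_nat_add of_nat_mult of_nat_numeral)
  then have "\<Sum>({a..b} - {m}) = n\<^sup>2 \<longleftrightarrow> 2 * int k = int n * (2 * int a + 1 - int n)"
    by (simp only: of_nat_eq_iff[where 'a = int, symmetric] of_nat_power)
      (auto simp: power2_eq_square algebra_simps)
  also have "\<dots> \<longleftrightarrow> n = 2 * a \<and> k = a"
  proof
    assume eq: "2 * int k = int n * (2 * int a + 1 - int n)"
    have "int n * 0 < int n * (2 * int a + 1 - int n)" "int n * (2 * int a + 1 - int n) < int n * 2"
      using k by (simp_all flip: eq)
    then have "2 * int a + 1 - int n = 1"
      using k by (simp only: mult_less_cancel_left_pos)
    with eq show "n = 2 * a \<and> k = a" by auto
  qed auto
  also have "\<dots> \<longleftrightarrow> b = 3 * a \<and> m = 2 * a"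
    by (auto simp: b m)
  finally show ?thesis by (simp only: card)
qed

text \<open>
  The pairing is indexed by the difference \<open>d = 2 * a + (\<sigma> x - x)\<close>: differences above \<open>2 * a\<close>
  come from \<open>x = d - 2 * a \<le> a\<close>, joined to the even number \<open>2 * a + 2 * x\<close>; differences below
  \<open>2 * a\<close> come from \<open>x = d + 1 > a\<close>, joined to the odd number \<open>2 * x - 1\<close>.
\<close>

lemma perfect_skolem_set_punctured_interval:
  fixes a :: nat
  assumes "a > 0"
  shows "perfect_skolem_set ({a..3 * a} - {2 * a})"
proof -
  define A where "A = {a..3 * a} - {2 * a}"
  define t where "t d = (if d < 2 * a then d + 1 else d - 2 * a)" for d
  have card: "card A = 2 * a"
    by (simp add: A_def)
  have "disjoint_family_on (\<lambda>d. {t d + d, t d}) A"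
    unfolding disjoint_family_on_def
  proof (intro ballI impI)
    fix d e assume "d \<in> A" "e \<in> A" "d \<noteq> e"
    then show "{t d + d, t d} \<inter> {t e + e, t e} = {}"
      unfolding A_def t_def by (auto split: if_splits; presburger)
  qed
  moreover have "(\<Union>d\<in>A. {t d + d, t d}) = {1..2 * card A}"
  proof
    show "(\<Union>d\<in>A. {t d + d, t d}) \<subseteq> {1..2 * card A}"
      unfolding card by (auto simp: A_def t_def split: if_splits)
    show "{1..2 * card A} \<subseteq> (\<Union>d\<in>A. {t d + d, t d})"
    proof
      fix y assume "y \<in> {1..2 * card A}"
      then have y: "1 \<le> y" "y \<le> 4 * a" by (simp_all add: card)
      consider "y \<le> a" | "a < y" "y \<le> 2 * a" | "2 * a < y" "even y" | "2 * a < y" "odd y"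
        by linarith
      then have "\<exists>d\<in>A. y = t d \<or> y = t d + d"
      proof cases
        case 1
        with y show ?thesis by (intro bexI[of _ "y + 2 * a"]) (auto simp: A_def t_def)
      next
        case 2
        with y show ?thesis by (intro bexI[of _ "y - 1"]) (auto simp: A_def t_def)
      next
        case 3
        then obtain z where "y = 2 * z" by (elim evenE)
        with 3 y show ?thesis by (intro bexI[of _ "a + z"]) (auto simp: A_def t_def)
      next
        case 4
        then obtain z where "y = 2 * z + 1" by (elim oddE)
        with 4 y show ?thesis by (intro bexI[of _ z]) (auto simp: A_def t_def)
      qed
      then show "y \<in> (\<Union>d\<in>A. {t d + d, t d})" by auto
    qed
  qed
  moreover have "finite A" "\<forall>d\<in>A. d > 0"
    using assms by (auto simp: A_def)
  ultimately show ?thesis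
    unfolding perfect_skolem_set_def A_def[symmetric]
    by (intro conjI exI[of _ "\<lambda>d. t d + d"] exI[of _ t]) auto
qed

theorem theorem28:
  fixes a m b :: nat
  assumes "a > 0" and "a < m" and "m < b"
  shows "perfect_extremal_skolem_set ({a..b} - {m}) \<longleftrightarrow>
           b = 3 * a \<and> real m = (real a + real b) / 2"
proof -
  have "perfect_extremal_skolem_set ({a..b} - {m}) \<longleftrightarrow> b = 3 * a \<and> m = 2 * a"
    unfolding perfect_extremal_skolem_set_def
      sum_punctured_interval_eq_card_squared_iff[OF assms(2,3)]
    using perfect_skolem_set_punctured_interval[OF assms(1)] by auto
  also have "\<dots> \<longleftrightarrow> b = 3 * a \<and> real m = (real a + real b) / 2"
    by auto
  finally show ?thesis .
qed

end
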